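(* Up to isomorphism, there exist exactly $21$ nonabelian noncommutative nontrivial dimonoids of order $3$. Among them there are exactly $10$ pairs of dual dimonoids (that is, $20$ of the $21$ isomorphism classes are partitioned into $10$ two-element sets, each consisting of the classes of some dimonoid and of its dual, which are not isomorphic to each other), and a single iso-dual dimonoid.
   Context: A dimonoid is a set $D$ with two associative binary operations $\dashv,\vdash$ satisfying, for all $x,y,z\in D$: $(D_1)$ $(x\dashv y)\dashv z=x\dashv(y\vdash z)$; $(D_2)$ $(x\vdash y)\dashv z=x\vdash(y\dashv z)$; $(D_3)$ $(x\dashv y)\vdash z=x\vdash(y\vdash z)$. Its order is $|D|$. It is trivial if the operations $\dashv$ and $\vdash$ coincide, and nontrivial otherwise. A dimonoid is commutative if both $\dashv$ and $\vdash$ are commutative (noncommutative means not commutative, i.e. at least one of the two operations is not commutative). It is abelian if $x\dashv y=y\vdash x$ for all $x,y$ (nonabelian means not abelian). The dual dimonoid of $(D,\dashv,\vdash)$ is $(D,\dashv^d,\vdash^d)$ with $x\dashv^d y=y\vdash x$ and $x\vdash^d y=y\dashv x$. A dimonoid is iso-dual if it is isomorphic to its dual dimonoid. An isomorphism of dimonoids is a bijection preserving both operations. *)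

theory Defs
  imports "HOL-Library.Disjoint_Sets" "HOL-Algebra.Congruence"
begin

record 'a two_ops = "'a partial_object" +
  left_op  :: "['a, 'a] \<Rightarrow> 'a"  (infixl "\<stileturn>\<index>" 70)
  right_op :: "['a, 'a] \<Rightarrow> 'a"  (infixl "\<turnstile>\<index>" 70)

locale dimonoid =
  fixes D :: "('a, 'm) two_ops_scheme" (structure)
  assumes left_closed:  "\<lbrakk>x \<in> carrier D; y \<in> carrier D\<rbrakk> \<Longrightarrow> x \<stileturn> y \<in> carrier D"
    and right_closed: "\<lbrakk>x \<in> carrier D; y \<in> carrier D\<rbrakk> \<Longrightarrow> x \<turnstile> y \<in> carrier D"
    and left_assoc:
      "\<lbrakk>x \<in> carrier D; y \<in> carrier D; z \<in> carrier D\<rbrakk> \<Longrightarrow> (x \<stileturn> y) \<stileturn> z = x \<stileturn> (y \<stileturn> z)"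
    and right_assoc:
      "\<lbrakk>x \<in> carrier D; y \<in> carrier D; z \<in> carrier D\<rbrakk> \<Longrightarrow> (x \<turnstile> y) \<turnstile> z = x \<turnstile> (y \<turnstile> z)"
    and D1: "\<lbrakk>x \<in> carrier D; y \<in> carrier D; z \<in> carrier D\<rbrakk> \<Longrightarrow> (x \<stileturn> y) \<stileturn> z = x \<stileturn> (y \<turnstile> z)"
    and D2: "\<lbrakk>x \<in> carrier D; y \<in> carrier D; z \<in> carrier D\<rbrakk> \<Longrightarrow> (x \<turnstile> y) \<stileturn> z = x \<turnstile> (y \<stileturn> z)"
    and D3: "\<lbrakk>x \<in> carrier D; y \<in> carrier D; z \<in> carrier D\<rbrakk> \<Longrightarrow> (x \<stileturn> y) \<turnstile> z = x \<turnstile> (y \<turnstile> z)"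

definition trivial_dimonoid :: "('a, 'm) two_ops_scheme \<Rightarrow> bool" where
  "trivial_dimonoid D \<longleftrightarrow>
    (\<forall>x\<in>carrier D. \<forall>y\<in>carrier D. x \<stileturn>\<^bsub>D\<^esub> y = x \<turnstile>\<^bsub>D\<^esub> y)"

definition commutative_dimonoid :: "('a, 'm) two_ops_scheme \<Rightarrow> bool" where
  "commutative_dimonoid D \<longleftrightarrow>
    (\<forall>x\<in>carrier D. \<forall>y\<in>carrier D. x \<stileturn>\<^bsub>D\<^esub> y = y \<stileturn>\<^bsub>D\<^esub> x) \<and>
    (\<forall>x\<in>carrier D. \<forall>y\<in>carrier D. x \<turnstile>\<^bsub>D\<^esub> y = y \<turnstile>\<^bsub>D\<^esub> x)"

definition abelian_dimonoid :: "('a, 'm) two_ops_scheme \<Rightarrow> bool" where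
  "abelian_dimonoid D \<longleftrightarrow>
    (\<forall>x\<in>carrier D. \<forall>y\<in>carrier D. x \<stileturn>\<^bsub>D\<^esub> y = y \<turnstile>\<^bsub>D\<^esub> x)"

definition dual_dimonoid :: "'a two_ops \<Rightarrow> 'a two_ops" where
  "dual_dimonoid D =
    \<lparr>carrier = carrier D,
     left_op = (\<lambda>x y. y \<turnstile>\<^bsub>D\<^esub> x),
     right_op = (\<lambda>x y. y \<stileturn>\<^bsub>D\<^esub> x)\<rparr>"

definition isomorphic_dimonoids ::
    "('a, 'm) two_ops_scheme \<Rightarrow> ('b, 'n) two_ops_scheme \<Rightarrow> bool" where
  "isomorphic_dimonoids D E \<longleftrightarrow>
    (\<exists>f. bij_betw f (carrier D) (carrier E) \<and>
      (\<forall>x\<in>carrier D. \<forall>y\<in>carrier D.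
        f (x \<stileturn>\<^bsub>D\<^esub> y) = f x \<stileturn>\<^bsub>E\<^esub> f y \<and>
        f (x \<turnstile>\<^bsub>D\<^esub> y) = f x \<turnstile>\<^bsub>E\<^esub> f y))"

definition iso_dual_dimonoid :: "'a two_ops \<Rightarrow> bool" where
  "iso_dual_dimonoid D \<longleftrightarrow> isomorphic_dimonoids D (dual_dimonoid D)"

text \<open>The values of the operations outside the carrier are left unspecified. They affect neither
  membership in the following set nor isomorphism, so they do not affect isomorphism classes.\<close>

definition nonab_noncomm_nontriv_3 :: "'a two_ops set" where
  "nonab_noncomm_nontriv_3 =
    {D. dimonoid D \<and> card (carrier D) = 3 \<and>
        \<not> abelian_dimonoid D \<and> \<not> commutative_dimonoid D \<and> \<not> trivial_dimonoid D}"

definition iso_rel_on :: "'a two_ops set \<Rightarrow> 'a two_ops rel" where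
  "iso_rel_on K = {(D, E). D \<in> K \<and> E \<in> K \<and> isomorphic_dimonoids D E}"

end

theory Submission
  imports Defs
begin

text \<open>Transporting the operations along a bijection turns a dimonoid of order 3 into a pair of
  multiplication tables on three points, and isomorphism into simultaneous relabelling of both tables
  by one of the six permutations. By a finite computation every associative table relabels to one of 24
  representatives. So it suffices to examine the pairs consisting of a representative and a relabelled
  representative; those that satisfy the dimonoid axioms and the three exclusions fall into 21
  relabelling classes. One of them is self-dual, the others are 10 classes and their duals.\<close>

subsection \<open>Multiplication tables on three points\<close>

datatype pt = P0 | P1 | P2

lemma all_pt_iff: "(\<forall>x. P x) \<longleftrightarrow> P P0 \<and> P P1 \<and> P P2"
  by (metis pt.exhaust)

lemma UNIV_pt: "UNIV = {P0, P1, P2}"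
  using pt.exhaust by auto

text \<open>Triples stand for functions on \<open>pt\<close>. As concrete data they can be compared
  and looked up in lists by evaluation; \<open>entry\<close> and \<open>tabulate\<close> translate
  in both directions.\<close>

type_synonym 'b triple = "'b \<times> 'b \<times> 'b"

fun entry :: "'b triple \<Rightarrow> pt \<Rightarrow> 'b" where
  "entry (a, b, c) P0 = a"
| "entry (a, b, c) P1 = b"
| "entry (a, b, c) P2 = c"

definition tabulate :: "(pt \<Rightarrow> 'b) \<Rightarrow> 'b triple" where
  "tabulate f = (f P0, f P1, f P2)"

lemma entry_tabulate [simp]: "entry (tabulate f) x = f x"
  by (cases x) (auto simp: tabulate_def)

lemma triple_eq_iff: "t = u \<longleftrightarrow> (\<forall>x. entry t x = entry u x)"
  by (cases t; cases u) (simp add: all_pt_iff)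

type_synonym table = "pt triple triple"

abbreviation app :: "table \<Rightarrow> pt \<Rightarrow> pt \<Rightarrow> pt" where
  "app t x \<equiv> entry (entry t x)"

lemma table_eq_iff: "t = u \<longleftrightarrow> (\<forall>x y. app t x y = app u x y)"
  by (simp add: triple_eq_iff)

definition transpose_table :: "table \<Rightarrow> table" where
  "transpose_table t = tabulate (\<lambda>x. tabulate (\<lambda>y. app t y x))"

lemma app_transpose_table [simp]: "app (transpose_table t) x y = app t y x"
  by (simp add: transpose_table_def)

definition perms :: "pt triple list" where
  "perms = [(P0, P1, P2), (P0, P2, P1), (P1, P0, P2), (P1, P2, P0), (P2, P0, P1), (P2, P1, P0)]"

lemma bij_entry_iff:
  fixes p :: "pt triple"
  shows "bij (entry p) \<longleftrightarrow> entry p P0 \<noteq> entry p P1 \<and> entry p P0 \<noteq> entry p P2 \<and> entry p P1 \<noteq> entry p P2"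
proof -
  have "finite (UNIV :: pt set)"
    unfolding UNIV_pt by simp
  then have "bij (entry p) \<longleftrightarrow> inj (entry p)"
    unfolding bij_def using finite_UNIV_inj_surj by blast
  also have "\<dots> \<longleftrightarrow> entry p P0 \<noteq> entry p P1 \<and> entry p P0 \<noteq> entry p P2 \<and> entry p P1 \<noteq> entry p P2"
    unfolding inj_def all_pt_iff by auto
  finally show ?thesis .
qed

lemma set_perms: "set perms = {p. bij (entry p)}"
proof -
  have "(a, b, c) \<in> set perms \<longleftrightarrow> a \<noteq> b \<and> a \<noteq> c \<and> b \<noteq> c" for a b c
    by (cases a; cases b; cases c) (simp_all add: perms_def)
  then show ?thesis
    by (auto simp: bij_entry_iff)
qed

text \<open>A computable stand-in for \<open>inv (entry p)\<close>, which is defined by choice. The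
  last branch \<open>P2\<close> is a default; for a bijection it is reached only at the image of
  \<open>P2\<close>.\<close>

definition preim :: "pt triple \<Rightarrow> pt \<Rightarrow> pt" where
  "preim p y = (if entry p P0 = y then P0 else if entry p P1 = y then P1 else P2)"

lemma preim_eq_inv:
  assumes "bij (entry p)"
  shows "preim p = inv (entry p)"
proof
  fix y
  obtain x where y: "y = entry p x"
    using assms by (metis bij_pointE)
  have "inj (entry p)"
    using assms by (rule bij_is_inj)
  then show "preim p y = inv (entry p) y"
    by (cases x) (auto simp: y preim_def inj_eq)
qed

definition relabel :: "pt triple \<Rightarrow> table \<Rightarrow> table" where
  "relabel p t = tabulate (\<lambda>x. tabulate (\<lambda>y. entry p (app t (preim p x) (preim p y))))"

text \<open>Every point has the form \<open>entry p x\<close>. Comparing both tables at such points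
  cancels \<open>preim\<close> and leaves the homomorphism equations.\<close>

lemma relabel_eq_iff:
  assumes "bij (entry p)"
  shows "relabel p t = u \<longleftrightarrow> (\<forall>x y. entry p (app t x y) = app u (entry p x) (entry p y))"
proof -
  have "(\<forall>x. P x) \<longleftrightarrow> (\<forall>x. P (entry p x))" for P
    using assms by (metis bij_pointE)
  note all_iff = this
  have "relabel p t = u \<longleftrightarrow> (\<forall>x y. app (relabel p t) (entry p x) (entry p y) = app u (entry p x) (entry p y))"
    unfolding table_eq_iff
    by (subst all_iff) (subst (2) all_iff, rule refl)
  then show ?thesis
    by (simp add: relabel_def preim_eq_inv [OF assms] bij_is_inj [OF assms])
qed

text \<open>The inverse permutation, tabulated, undoes the relabelling. This later recovers a table
  from its normalized form.\<close>

lemma relabel_inverse: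
  assumes "bij (entry p)"
  obtains q where "bij (entry q)" "relabel q (relabel p t) = t"
proof -
  define q where "q = tabulate (inv (entry p))"
  have q: "entry q = inv (entry p)"
    by (simp add: q_def fun_eq_iff)
  have "bij (entry q)"
    using assms by (simp add: q bij_imp_bij_inv)
  moreover from this have "relabel q (relabel p t) = t"
    by (simp add: relabel_eq_iff) (simp add: q relabel_def preim_eq_inv [OF assms] bij_is_inj [OF assms])
  ultimately show thesis
    by (rule that)
qed

type_synonym code = "table \<times> table"

definition relabel_code :: "pt triple \<Rightarrow> code \<Rightarrow> code" where
  "relabel_code p c = (relabel p (fst c), relabel p (snd c))"

definition dual_code :: "code \<Rightarrow> code" where
  "dual_code c = (transpose_table (snd c), transpose_table (fst c))"

lemma dual_code_dual_code [simp]: "dual_code (dual_code c) = c"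
  unfolding prod_eq_iff [of _ c] by (simp add: dual_code_def table_eq_iff)

subsection \<open>Enumeration up to relabelling\<close>

text \<open>The predicates below are evaluated by the simplifier. It rewrites under abstractions,
  so every quantified body is named and only ever passed around partially applied.\<close>

definition all_pts :: "(pt \<Rightarrow> bool) \<Rightarrow> bool" where
  "all_pts P \<longleftrightarrow> P P0 \<and> P P1 \<and> P P2"

lemma all_pts_iff: "all_pts P \<longleftrightarrow> (\<forall>x. P x)"
  by (simp add: all_pts_def all_pt_iff)

definition all_pts2 :: "(pt \<Rightarrow> pt \<Rightarrow> bool) \<Rightarrow> pt \<Rightarrow> bool" where
  "all_pts2 P x \<longleftrightarrow> all_pts (P x)"

definition all_pts3 :: "(pt \<Rightarrow> pt \<Rightarrow> pt \<Rightarrow> bool) \<Rightarrow> pt \<Rightarrow> bool" where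
  "all_pts3 P x \<longleftrightarrow> all_pts (all_pts2 (P x))"

text \<open>Four table arguments make one equation shape serve for both associative laws and for D1,
  D2 and D3.\<close>

definition mixed_assoc_at :: "table \<Rightarrow> table \<Rightarrow> table \<Rightarrow> table \<Rightarrow> pt \<Rightarrow> pt \<Rightarrow> pt \<Rightarrow> bool" where
  "mixed_assoc_at s t u v x y z \<longleftrightarrow> app s (app t x y) z = app u x (app v y z)"

definition mixed_assoc :: "table \<Rightarrow> table \<Rightarrow> table \<Rightarrow> table \<Rightarrow> bool" where
  "mixed_assoc s t u v \<longleftrightarrow> all_pts (all_pts3 (mixed_assoc_at s t u v))"

lemma mixed_assoc_iff:
  "mixed_assoc s t u v \<longleftrightarrow> (\<forall>x y z. app s (app t x y) z = app u x (app v y z))"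
  by (simp add: mixed_assoc_def all_pts3_def all_pts2_def all_pts_iff mixed_assoc_at_def)

text \<open>The first three conditions are D1, D2 and D3. They precede associativity because the
  tables met in the enumeration are associative already, so a failing axiom is one of these.\<close>

fun nonab_noncomm_nontriv_code :: "code \<Rightarrow> bool" where
  "nonab_noncomm_nontriv_code (s, t) \<longleftrightarrow>
    mixed_assoc s s s t \<and> mixed_assoc s t t s \<and> mixed_assoc t s t t \<and>
    mixed_assoc s s s s \<and> mixed_assoc t t t t \<and>
    s \<noteq> transpose_table t \<and> (s \<noteq> transpose_table s \<or> t \<noteq> transpose_table t) \<and> s \<noteq> t"

definition relabels_to :: "code \<Rightarrow> code \<Rightarrow> pt triple \<Rightarrow> bool" where
  "relabels_to c d p \<longleftrightarrow> relabel_code p c = d"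

definition similar :: "code \<Rightarrow> code \<Rightarrow> bool" where
  "similar c d \<longleftrightarrow> list_ex (relabels_to c d) perms"

definition dissimilar :: "code \<Rightarrow> code \<Rightarrow> bool" where
  "dissimilar c d \<longleftrightarrow> \<not> similar c d"

text \<open>One representative of each of the 24 isomorphism classes of semigroups of order 3.\<close>

definition semigroup_reps :: "table list" where
  "semigroup_reps =
  [((P0, P0, P0), (P0, P0, P0), (P0, P0, P0)),
   ((P0, P0, P0), (P0, P0, P0), (P0, P0, P1)),
   ((P0, P0, P0), (P0, P0, P0), (P0, P0, P2)),
   ((P0, P0, P0), (P0, P0, P0), (P0, P1, P2)),
   ((P0, P0, P0), (P0, P0, P0), (P2, P2, P2)),
   ((P0, P0, P0), (P0, P0, P1), (P0, P0, P2)),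
   ((P0, P0, P0), (P0, P0, P1), (P0, P1, P2)),
   ((P0, P0, P0), (P0, P1, P0), (P0, P0, P2)),
   ((P0, P0, P0), (P0, P1, P0), (P2, P2, P2)),
   ((P0, P0, P0), (P0, P1, P1), (P0, P1, P1)),
   ((P0, P0, P0), (P0, P1, P1), (P0, P1, P2)),
   ((P0, P0, P0), (P0, P1, P1), (P0, P2, P2)),
   ((P0, P0, P0), (P0, P1, P2), (P0, P1, P2)),
   ((P0, P0, P0), (P0, P1, P2), (P0, P2, P1)),
   ((P0, P0, P0), (P0, P1, P2), (P2, P2, P2)),
   ((P0, P0, P0), (P1, P1, P1), (P2, P2, P2)),
   ((P0, P0, P2), (P0, P0, P2), (P0, P0, P2)),
   ((P0, P0, P2), (P0, P0, P2), (P2, P2, P0)),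
   ((P0, P0, P2), (P0, P1, P2), (P0, P0, P2)),
   ((P0, P0, P2), (P0, P1, P2), (P0, P2, P2)),
   ((P0, P0, P2), (P0, P1, P2), (P2, P2, P0)),
   ((P0, P1, P1), (P1, P0, P0), (P1, P0, P0)),
   ((P0, P1, P2), (P0, P1, P2), (P0, P1, P2)),
   ((P0, P1, P2), (P1, P2, P0), (P2, P0, P1))]"

definition pts :: "pt list" where
  "pts = [P0, P1, P2]"

definition rows :: "pt triple list" where
  "rows = List.product pts (List.product pts pts)"

lemma in_set_rows: "r \<in> set rows"
proof -
  have "set pts = UNIV"
    by (simp add: pts_def UNIV_pt)
  then show ?thesis
    by (simp add: rows_def mem_Times_iff)
qed

definition relabels_to_rep :: "table \<Rightarrow> pt triple \<Rightarrow> bool" where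
  "relabels_to_rep t p \<longleftrightarrow> relabel p t \<in> set semigroup_reps"

text \<open>The conditional, in place of an implication, keeps the search over permutations from
  being evaluated for nonassociative tables.\<close>

definition semigroup_covered :: "pt triple \<Rightarrow> pt triple \<Rightarrow> pt triple \<Rightarrow> bool" where
  "semigroup_covered q r s \<longleftrightarrow>
    (if mixed_assoc (q, r, s) (q, r, s) (q, r, s) (q, r, s)
     then list_ex (relabels_to_rep (q, r, s)) perms else True)"

definition semigroups_covered2 :: "pt triple \<Rightarrow> pt triple \<Rightarrow> bool" where
  "semigroups_covered2 q r \<longleftrightarrow> list_all (semigroup_covered q r) rows"

definition semigroups_covered :: "pt triple \<Rightarrow> bool" where
  "semigroups_covered q \<longleftrightarrow> list_all (semigroups_covered2 q) rows"

text \<open>Exhaustive search through all 27^3 tables, row by row.\<close>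

lemma all_semigroups_covered: "list_all semigroups_covered rows"
  by code_simp

lemma semigroup_relabel:
  assumes "mixed_assoc t t t t"
  obtains p where "p \<in> set perms" "relabel p t \<in> set semigroup_reps"
proof -
  obtain q r s where t: "t = (q, r, s)"
    by (cases t)
  have "semigroup_covered q r s"
    using all_semigroups_covered in_set_rows
    unfolding semigroups_covered_def semigroups_covered2_def list_all_iff by blast
  then have "\<exists>p\<in>set perms. relabels_to_rep t p"
    using assms unfolding semigroup_covered_def t list_ex_iff by metis
  then show thesis
    using that unfolding relabels_to_rep_def by blast
qed

section \<open>The 21 representatives and their verification\<close>

definition self_dual_rep :: code where
  "self_dual_rep =
   (((P0, P0, P0), (P0, P0, P0), (P2, P2, P2)),
    ((P0, P1, P0), (P0, P1, P0), (P0, P1, P0)))"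

text \<open>One member of each dual pair. The other members are obtained in \<open>reps\<close> by
  dualizing, so that the pairing can be read off the list.\<close>

definition half_reps :: "code list" where
  "half_reps =
  [(((P0, P0, P0), (P0, P0, P0), (P0, P0, P0)),
    ((P0, P0, P2), (P0, P0, P2), (P0, P0, P2))),
   (((P0, P0, P0), (P0, P0, P0), (P0, P0, P0)),
    ((P0, P1, P1), (P0, P1, P1), (P0, P1, P1))),
   (((P0, P0, P0), (P0, P0, P0), (P0, P0, P0)),
    ((P0, P1, P2), (P0, P1, P2), (P0, P1, P2))),
   (((P0, P0, P0), (P0, P0, P0), (P0, P0, P2)),
    ((P0, P0, P0), (P0, P0, P0), (P0, P1, P2))),
   (((P0, P0, P0), (P0, P0, P0), (P0, P0, P2)),
    ((P0, P1, P0), (P0, P1, P0), (P0, P1, P2))),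
   (((P0, P0, P0), (P0, P0, P0), (P2, P2, P2)),
    ((P0, P1, P2), (P0, P1, P2), (P0, P1, P2))),
   (((P0, P0, P0), (P0, P0, P1), (P0, P0, P2)),
    ((P0, P1, P0), (P0, P1, P0), (P0, P1, P2))),
   (((P0, P0, P0), (P0, P0, P1), (P0, P0, P2)),
    ((P0, P1, P1), (P0, P1, P1), (P0, P1, P2))),
   (((P0, P0, P0), (P0, P1, P1), (P0, P1, P1)),
    ((P0, P0, P0), (P0, P1, P2), (P0, P1, P2))),
   (((P0, P0, P0), (P1, P1, P1), (P2, P2, P2)),
    ((P0, P0, P0), (P0, P0, P0), (P2, P2, P2)))]"

definition reps :: "code list" where
  "reps = self_dual_rep # half_reps @ map dual_code half_reps"

text \<open>The list of targets is a parameter, so that \<open>reps\<close> with its dualized half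
  can be computed once instead of for every pair of tables.\<close>

definition relabels_into :: "code list \<Rightarrow> code \<Rightarrow> pt triple \<Rightarrow> bool" where
  "relabels_into cs c p \<longleftrightarrow> relabel_code p c \<in> set cs"

definition code_covered :: "code list \<Rightarrow> code \<Rightarrow> bool" where
  "code_covered cs c \<longleftrightarrow> (if nonab_noncomm_nontriv_code c then list_ex (relabels_into cs c) perms else True)"

definition dimonoid_covered :: "code list \<Rightarrow> table \<Rightarrow> table \<Rightarrow> pt triple \<Rightarrow> bool" where
  "dimonoid_covered cs s t p \<longleftrightarrow> code_covered cs (s, relabel p t)"

definition dimonoids_covered2 :: "code list \<Rightarrow> table \<Rightarrow> table \<Rightarrow> bool" where
  "dimonoids_covered2 cs s t \<longleftrightarrow> list_all (dimonoid_covered cs s t) perms"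

definition dimonoids_covered :: "code list \<Rightarrow> table \<Rightarrow> bool" where
  "dimonoids_covered cs s \<longleftrightarrow> list_all (dimonoids_covered2 cs s) semigroup_reps"

text \<open>The search runs over 24 * 24 * 6 pairs: the first table is a representative, the second
  a representative relabelled by any of the six permutations.\<close>

lemma all_dimonoids_covered: "list_all (dimonoids_covered reps) semigroup_reps"
  by code_simp

lemma nonab_noncomm_nontriv_code_reps: "list_all nonab_noncomm_nontriv_code reps"
  by code_simp

text \<open>Each entry is compared with later entries only. This suffices because the conclusion
  drawn from it, that the classes differ, is symmetric.\<close>

lemma reps_dissimilar: "sorted_wrt dissimilar reps"
  by code_simp

text \<open>Exchanging \<open>P1\<close> and \<open>P2\<close> is the witness. The left product
  applies to its left factor the map that sends \<open>P1\<close> to \<open>P0\<close> and fixes the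
  rest; the right product applies to its right factor the map that sends \<open>P2\<close> to
  \<open>P0\<close> and fixes the rest. Dualizing exchanges the two maps, and so does the
  transposition.\<close>

lemma similar_dual_self_dual_rep: "similar self_dual_rep (dual_code self_dual_rep)"
  by code_simp

lemma length_half_reps: "length half_reps = 10"
  by (simp add: half_reps_def)

subsection \<open>Isomorphisms of dimonoids\<close>

lemma isomorphic_dimonoids_refl: "isomorphic_dimonoids D D"
  unfolding isomorphic_dimonoids_def by (rule exI [of _ id]) simp

lemma isomorphic_dimonoids_trans:
  assumes "isomorphic_dimonoids D E" "isomorphic_dimonoids E F"
  shows "isomorphic_dimonoids D F"
proof -
  obtain f where f: "bij_betw f (carrier D) (carrier E)"
    "\<And>x y. \<lbrakk>x \<in> carrier D; y \<in> carrier D\<rbrakk> \<Longrightarrow> f (x \<stileturn>\<^bsub>D\<^esub> y) = f x \<stileturn>\<^bsub>E\<^esub> f y"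
    "\<And>x y. \<lbrakk>x \<in> carrier D; y \<in> carrier D\<rbrakk> \<Longrightarrow> f (x \<turnstile>\<^bsub>D\<^esub> y) = f x \<turnstile>\<^bsub>E\<^esub> f y"
    using assms(1) unfolding isomorphic_dimonoids_def by blast
  obtain g where g: "bij_betw g (carrier E) (carrier F)"
    "\<And>x y. \<lbrakk>x \<in> carrier E; y \<in> carrier E\<rbrakk> \<Longrightarrow> g (x \<stileturn>\<^bsub>E\<^esub> y) = g x \<stileturn>\<^bsub>F\<^esub> g y"
    "\<And>x y. \<lbrakk>x \<in> carrier E; y \<in> carrier E\<rbrakk> \<Longrightarrow> g (x \<turnstile>\<^bsub>E\<^esub> y) = g x \<turnstile>\<^bsub>F\<^esub> g y"
    using assms(2) unfolding isomorphic_dimonoids_def by blast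
  have "bij_betw (g \<circ> f) (carrier D) (carrier F)"
    using f(1) g(1) by (rule bij_betw_trans)
  moreover have "f x \<in> carrier E" if "x \<in> carrier D" for x
    using f(1) that by (rule bij_betwE [rule_format])
  ultimately show ?thesis
    unfolding isomorphic_dimonoids_def by (intro exI [of _ "g \<circ> f"]) (simp add: f g)
qed

text \<open>The inverse map is again a homomorphism because products in \<open>D\<close> stay in the
  carrier, where \<open>inv_into\<close> cancels \<open>f\<close>.\<close>

lemma isomorphic_dimonoids_sym:
  assumes "dimonoid D" "isomorphic_dimonoids D E"
  shows "isomorphic_dimonoids E D"
proof -
  interpret dimonoid D by fact
  obtain f where f: "bij_betw f (carrier D) (carrier E)"
    and hom: "\<And>x y. \<lbrakk>x \<in> carrier D; y \<in> carrier D\<rbrakk> \<Longrightarrow> f (x \<stileturn>\<^bsub>D\<^esub> y) = f x \<stileturn>\<^bsub>E\<^esub> f y"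
    "\<And>x y. \<lbrakk>x \<in> carrier D; y \<in> carrier D\<rbrakk> \<Longrightarrow> f (x \<turnstile>\<^bsub>D\<^esub> y) = f x \<turnstile>\<^bsub>E\<^esub> f y"
    using assms(2) unfolding isomorphic_dimonoids_def by blast
  have carrier: "carrier E = f ` carrier D" and inj: "inj_on f (carrier D)"
    using f by (auto simp: bij_betw_def)
  show ?thesis
    unfolding isomorphic_dimonoids_def
    by (intro exI [of _ "inv_into (carrier D) f"] conjI bij_betw_inv_into f)
      (simp add: carrier inj left_closed right_closed flip: hom)
qed

text \<open>All elements of \<open>E\<close> are images under \<open>f\<close>. Reading the
  homomorphism equations from right to left turns both sides of an axiom for \<open>E\<close> into
  images of the sides of that axiom for \<open>D\<close>.\<close>

lemma dimonoid_isomorphic: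
  assumes "dimonoid D" "isomorphic_dimonoids D E"
  shows "dimonoid E"
proof -
  interpret dimonoid D by fact
  obtain f where f: "bij_betw f (carrier D) (carrier E)"
    and hom: "\<And>x y. \<lbrakk>x \<in> carrier D; y \<in> carrier D\<rbrakk> \<Longrightarrow> f (x \<stileturn>\<^bsub>D\<^esub> y) = f x \<stileturn>\<^bsub>E\<^esub> f y"
    "\<And>x y. \<lbrakk>x \<in> carrier D; y \<in> carrier D\<rbrakk> \<Longrightarrow> f (x \<turnstile>\<^bsub>D\<^esub> y) = f x \<turnstile>\<^bsub>E\<^esub> f y"
    using assms(2) unfolding isomorphic_dimonoids_def by blast
  have carrier: "carrier E = f ` carrier D"
    using f by (auto simp: bij_betw_def)
  show ?thesis
    by unfold_locales
      (auto simp: carrier left_closed right_closed simp flip: hom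
        intro!: arg_cong [where f = f] intro: left_assoc right_assoc D1 D2 D3)
qed

text \<open>The three excluded properties are equations between products, which an injective
  homomorphism both preserves and reflects.\<close>

lemma nonab_noncomm_nontriv_3_isomorphic:
  assumes D: "D \<in> nonab_noncomm_nontriv_3" and iso: "isomorphic_dimonoids D E"
  shows "E \<in> nonab_noncomm_nontriv_3"
proof -
  interpret dimonoid D
    using D by (simp add: nonab_noncomm_nontriv_3_def)
  obtain f where f: "bij_betw f (carrier D) (carrier E)"
    and hom: "\<And>x y. \<lbrakk>x \<in> carrier D; y \<in> carrier D\<rbrakk> \<Longrightarrow> f (x \<stileturn>\<^bsub>D\<^esub> y) = f x \<stileturn>\<^bsub>E\<^esub> f y"
    "\<And>x y. \<lbrakk>x \<in> carrier D; y \<in> carrier D\<rbrakk> \<Longrightarrow> f (x \<turnstile>\<^bsub>D\<^esub> y) = f x \<turnstile>\<^bsub>E\<^esub> f y"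
    using iso unfolding isomorphic_dimonoids_def by blast
  have carrier: "carrier E = f ` carrier D" and inj: "inj_on f (carrier D)"
    using f by (auto simp: bij_betw_def)
  have "dimonoid E"
    using dimonoid_axioms iso by (rule dimonoid_isomorphic)
  moreover have "card (carrier E) = card (carrier D)"
    using f by (simp add: bij_betw_same_card)
  moreover have "abelian_dimonoid E \<longleftrightarrow> abelian_dimonoid D"
    by (simp add: abelian_dimonoid_def carrier inj_on_eq_iff [OF inj] left_closed right_closed flip: hom)
  moreover have "commutative_dimonoid E \<longleftrightarrow> commutative_dimonoid D"
    by (simp add: commutative_dimonoid_def carrier inj_on_eq_iff [OF inj] left_closed right_closed flip: hom)
  moreover have "trivial_dimonoid E \<longleftrightarrow> trivial_dimonoid D"
    by (simp add: trivial_dimonoid_def carrier inj_on_eq_iff [OF inj] left_closed right_closed flip: hom)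
  ultimately show ?thesis
    using D by (simp add: nonab_noncomm_nontriv_3_def)
qed

lemma isomorphic_dual_dimonoid:
  assumes "isomorphic_dimonoids D E"
  shows "isomorphic_dimonoids (dual_dimonoid D) (dual_dimonoid E)"
  using assms unfolding isomorphic_dimonoids_def dual_dimonoid_def by (simp only: two_ops.simps partial_object.simps) blast

lemma equiv_iso_rel_on: "equiv nonab_noncomm_nontriv_3 (iso_rel_on nonab_noncomm_nontriv_3)"
proof (rule equivI)
  show "refl_on nonab_noncomm_nontriv_3 (iso_rel_on nonab_noncomm_nontriv_3)"
    by (auto simp: refl_on_def iso_rel_on_def isomorphic_dimonoids_refl)
  show "sym (iso_rel_on nonab_noncomm_nontriv_3)"
    by (auto simp: sym_def iso_rel_on_def nonab_noncomm_nontriv_3_def intro: isomorphic_dimonoids_sym)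
  show "trans (iso_rel_on nonab_noncomm_nontriv_3)"
    by (auto simp: trans_def iso_rel_on_def intro: isomorphic_dimonoids_trans)
qed (auto simp: iso_rel_on_def)

subsection \<open>Dimonoids of order 3 as pairs of tables\<close>

text \<open>A copy of the coded structure inside an arbitrary type, placed along an injection
  \<open>g\<close>. With \<open>g\<close> fixed, all codes share the carrier
  \<open>range g\<close>.\<close>

definition realize :: "(pt \<Rightarrow> 'a) \<Rightarrow> code \<Rightarrow> 'a two_ops" where
  "realize g c =
    \<lparr>carrier = range g,
     left_op = (\<lambda>x y. g (app (fst c) (inv g x) (inv g y))),
     right_op = (\<lambda>x y. g (app (snd c) (inv g x) (inv g y)))\<rparr>"

lemma carrier_realize [simp]: "carrier (realize g c) = range g"
  by (simp add: realize_def)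

lemma realize_op [simp]:
  assumes "inj g"
  shows "g x \<stileturn>\<^bsub>realize g c\<^esub> g y = g (app (fst c) x y)"
    and "g x \<turnstile>\<^bsub>realize g c\<^esub> g y = g (app (snd c) x y)"
  using assms by (simp_all add: realize_def)

text \<open>This is an equality and not just an isomorphism, since the operations are given by the
  same formula outside the carrier too.\<close>

lemma dual_dimonoid_realize: "dual_dimonoid (realize g c) = realize g (dual_code c)"
  by (simp add: dual_dimonoid_def realize_def dual_code_def)

lemma realize_in_nonab_noncomm_nontriv_3_iff:
  assumes g: "inj g"
  shows "realize g c \<in> nonab_noncomm_nontriv_3 \<longleftrightarrow> nonab_noncomm_nontriv_code c"
proof -
  obtain s t where c: "c = (s, t)"
    by (cases c)
  \<comment> \<open>Quantifiers over the carrier become quantifiers over \<open>pt\<close>;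
    injectivity of \<open>g\<close> then strips \<open>g\<close> from every equation.\<close>
  have all_range: "(\<forall>x. x \<in> range g \<longrightarrow> P x) \<longleftrightarrow> (\<forall>x. P (g x))" for P
    by blast
  have "card (range g) = card (UNIV :: pt set)"
    using g by (rule card_image)
  then have "card (range g) = 3"
    unfolding UNIV_pt by simp
  moreover have "dimonoid (realize g c) \<longleftrightarrow>
      mixed_assoc s s s t \<and> mixed_assoc s t t s \<and> mixed_assoc t s t t \<and>
      mixed_assoc s s s s \<and> mixed_assoc t t t t"
    by (simp add: dimonoid_def mixed_assoc_iff all_range g inj_eq c) blast
  moreover have "abelian_dimonoid (realize g c) \<longleftrightarrow> s = transpose_table t"
    by (simp add: abelian_dimonoid_def table_eq_iff g inj_eq c)
  moreover have "commutative_dimonoid (realize g c) \<longleftrightarrow> s = transpose_table s \<and> t = transpose_table t"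
    by (simp add: commutative_dimonoid_def table_eq_iff g inj_eq c)
  moreover have "trivial_dimonoid (realize g c) \<longleftrightarrow> s = t"
    by (simp add: trivial_dimonoid_def table_eq_iff g inj_eq c)
  ultimately show ?thesis
    by (auto simp: nonab_noncomm_nontriv_3_def c)
qed

lemma isomorphic_realize:
  fixes D :: "'a two_ops"
  assumes card: "card (carrier D) = 3" and g: "inj g"
  obtains c where "isomorphic_dimonoids D (realize g c)"
proof -
  have "finite (UNIV :: pt set)" "finite (carrier D)" "card (UNIV :: pt set) = card (carrier D)"
    using card by (auto simp: UNIV_pt intro: card_ge_0_finite)
  then obtain h where h: "bij_betw h (UNIV :: pt set) (carrier D)"
    using finite_same_card_bij by blast
  then have carrier: "carrier D = range h" and inj: "inj h"
    by (auto simp: bij_betw_def)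
  \<comment> \<open>The operations of \<open>D\<close> are pulled back along the numbering
    \<open>h\<close> of its carrier.\<close>
  define c where "c = (tabulate (\<lambda>x. tabulate (\<lambda>y. inv h (h x \<stileturn>\<^bsub>D\<^esub> h y))),
    tabulate (\<lambda>x. tabulate (\<lambda>y. inv h (h x \<turnstile>\<^bsub>D\<^esub> h y))))"
  have "bij_betw (g \<circ> inv h) (carrier D) (range g)"
    using bij_betw_inv_into [OF h] g by (intro bij_betw_trans) (auto simp: bij_betw_def)
  then have "isomorphic_dimonoids D (realize g c)"
    unfolding isomorphic_dimonoids_def
    by (intro exI [of _ "g \<circ> inv h"]) (simp add: carrier inj g c_def)
  then show thesis
    by (rule that)
qed

section \<open>Similarity of codes as isomorphism of dimonoids\<close>

lemma similar_iff: "similar c d \<longleftrightarrow> (\<exists>p. bij (entry p) \<and> relabel_code p c = d)"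
  by (auto simp: similar_def relabels_to_def list_ex_iff set_perms)

lemma relabel_code_eq_iff:
  assumes "bij (entry p)"
  shows "relabel_code p c = d \<longleftrightarrow>
    (\<forall>x y. entry p (app (fst c) x y) = app (fst d) (entry p x) (entry p y) \<and>
           entry p (app (snd c) x y) = app (snd d) (entry p x) (entry p y))"
  by (cases d) (auto simp: relabel_code_def relabel_eq_iff [OF assms])

text \<open>Conjugation by \<open>g\<close> matches the bijections of \<open>range g\<close> with
  the permutations of \<open>pt\<close>, and the homomorphism equations with the relabelling
  equations.\<close>

lemma isomorphic_realize_iff:
  assumes g: "inj g"
  shows "isomorphic_dimonoids (realize g c) (realize g d) \<longleftrightarrow> similar c d"
proof
  assume "isomorphic_dimonoids (realize g c) (realize g d)"
  then obtain f where f: "bij_betw f (range g) (range g)"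
    and "\<And>x y. f (g x \<stileturn>\<^bsub>realize g c\<^esub> g y) = f (g x) \<stileturn>\<^bsub>realize g d\<^esub> f (g y)"
      "\<And>x y. f (g x \<turnstile>\<^bsub>realize g c\<^esub> g y) = f (g x) \<turnstile>\<^bsub>realize g d\<^esub> f (g y)"
    unfolding isomorphic_dimonoids_def by auto
  then have hom: "\<And>x y. f (g (app (fst c) x y)) = f (g x) \<stileturn>\<^bsub>realize g d\<^esub> f (g y)"
      "\<And>x y. f (g (app (snd c) x y)) = f (g x) \<turnstile>\<^bsub>realize g d\<^esub> f (g y)"
    by (simp_all add: g)
  have "bij_betw g UNIV (range g)"
    using g by (simp add: bij_betw_def)
  then have "bij_betw (inv g \<circ> (f \<circ> g)) UNIV UNIV"
    using f by (intro bij_betw_trans bij_betw_inv_into)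
  \<comment> \<open>The isomorphism \<open>f\<close>, read through \<open>g\<close>, is a
    permutation of the three points.\<close>
  moreover define p where "p = tabulate (inv g \<circ> (f \<circ> g))"
  ultimately have "bij (entry p)"
    by (simp add: fun_eq_iff cong: bij_betw_cong)
  moreover have p: "f (g x) = g (entry p x)" for x
    using bij_betwE [OF f] by (simp add: p_def f_inv_into_f)
  moreover have "relabel_code p c = d"
    using hom g by (simp add: relabel_code_eq_iff [OF \<open>bij (entry p)\<close>] p inj_eq)
  ultimately show "similar c d"
    unfolding similar_iff by blast
next
  assume "similar c d"
  then obtain p where p: "bij (entry p)" "relabel_code p c = d"
    unfolding similar_iff by blast
  have "bij_betw (inv g) (range g) UNIV"
    using g by (intro bij_betw_inv_into) (simp add: bij_betw_def)
  then have "bij_betw (entry p \<circ> inv g) (range g) UNIV"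
    using p(1) by (rule bij_betw_trans)
  then have "bij_betw (g \<circ> (entry p \<circ> inv g)) (range g) (range g)"
    by (rule bij_betw_trans) (simp add: g bij_betw_def)
  then show "isomorphic_dimonoids (realize g c) (realize g d)"
    unfolding isomorphic_dimonoids_def
    using p(2) [unfolded relabel_code_eq_iff [OF p(1)]] g
    by (intro exI [of _ "g \<circ> (entry p \<circ> inv g)"]) simp
qed

text \<open>Realizing codes on \<open>pt\<close> itself, with the identity as \<open>g\<close>,
  carries facts about isomorphism over to similarity.\<close>

lemma similar_trans:
  assumes "similar c d" "similar d e"
  shows "similar c e"
  using assms isomorphic_dimonoids_trans unfolding isomorphic_realize_iff [OF inj_on_id, symmetric] by blast

lemma nonab_noncomm_nontriv_code_similar:
  assumes "nonab_noncomm_nontriv_code c" "similar c d"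
  shows "nonab_noncomm_nontriv_code d"
  using assms nonab_noncomm_nontriv_3_isomorphic
  unfolding isomorphic_realize_iff [OF inj_on_id, symmetric]
    realize_in_nonab_noncomm_nontriv_3_iff [OF inj_on_id, symmetric]
  by blast

lemma nonab_noncomm_nontriv_code_similar_rep:
  assumes c: "nonab_noncomm_nontriv_code c"
  obtains d where "d \<in> set reps" "similar c d"
proof -
  have "mixed_assoc (fst c) (fst c) (fst c) (fst c)"
    using c by (cases c) simp
  then obtain p where p: "p \<in> set perms" "relabel p (fst c) \<in> set semigroup_reps"
    by (rule semigroup_relabel)
  define s where "s = relabel p (fst c)"
  define t where "t = relabel p (snd c)"
  have c_st: "similar c (s, t)"
    using p(1) unfolding similar_iff relabel_code_def s_def t_def set_perms by blast
  then have st: "nonab_noncomm_nontriv_code (s, t)"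
    using c nonab_noncomm_nontriv_code_similar by blast
  \<comment> \<open>Now \<open>s\<close> is a representative but \<open>t\<close> need not be one.
    The permutation \<open>q\<close> normalizes \<open>t\<close> alone, leaving \<open>s\<close>
    fixed, and its inverse \<open>r\<close> exhibits \<open>t\<close> as a relabelled
    representative, which is the form of pair searched.\<close>
  then obtain q where q: "q \<in> set perms" "relabel q t \<in> set semigroup_reps"
    using semigroup_relabel [of t] by auto
  then obtain r where r: "r \<in> set perms" "relabel r (relabel q t) = t"
    using relabel_inverse [of q t] by (auto simp: set_perms)
  have "dimonoid_covered reps s (relabel q t) r"
    using all_dimonoids_covered p(2) q(2) r(1)
    unfolding dimonoids_covered_def dimonoids_covered2_def list_all_iff s_def by blast
  then have "\<exists>p\<in>set perms. relabels_into reps (s, t) p"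
    using st unfolding dimonoid_covered_def code_covered_def r(2) list_ex_iff by metis
  then obtain d where "d \<in> set reps" "similar (s, t) d"
    unfolding relabels_into_def set_perms similar_iff by blast
  then show thesis
    using that similar_trans c_st by blast
qed

lemma iso_dual_dimonoid_isomorphic:
  assumes "dimonoid D" "isomorphic_dimonoids D E" "iso_dual_dimonoid D"
  shows "iso_dual_dimonoid E"
  using assms isomorphic_dimonoids_sym isomorphic_dual_dimonoid isomorphic_dimonoids_trans
  unfolding iso_dual_dimonoid_def by meson

section \<open>Counting the classes and pairing them by duality\<close>

lemma sorted_wrt_neq_iff_distinct: "sorted_wrt (\<noteq>) xs \<longleftrightarrow> distinct xs"
  by (induction xs) auto

text \<open>To be used with \<open>u c\<close> the class of a code and \<open>v c\<close> the class
  of its dual. The hypotheses make all these values different, so pairs for different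
  \<open>c\<close> are disjoint.\<close>

lemma partition_on_pairs:
  assumes "inj_on u H" "inj_on v H" "u ` H \<inter> v ` H = {}"
  shows "partition_on (u ` H \<union> v ` H) ((\<lambda>c. {u c, v c}) ` H)"
    and "card ((\<lambda>c. {u c, v c}) ` H) = card H"
    and "c \<in> H \<Longrightarrow> card {u c, v c} = 2"
proof -
  have uv: "u c \<noteq> v d" if "c \<in> H" "d \<in> H" for c d
    using assms(3) that by blast
  show "partition_on (u ` H \<union> v ` H) ((\<lambda>c. {u c, v c}) ` H)"
  proof (rule partition_onI)
    fix p q
    assume "p \<in> (\<lambda>c. {u c, v c}) ` H" "q \<in> (\<lambda>c. {u c, v c}) ` H" "p \<noteq> q"
    then obtain c d where cd: "c \<in> H" "d \<in> H" "p = {u c, v c}" "q = {u d, v d}" "c \<noteq> d"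
      by blast
    then have "u c \<noteq> u d" "v c \<noteq> v d" "u c \<noteq> v d" "v c \<noteq> u d"
      using assms(1,2) uv [of c d] uv [of d c] by (auto dest: inj_onD)
    then show "disjnt p q"
      by (simp add: cd disjnt_def)
  qed auto
  have "inj_on (\<lambda>c. {u c, v c}) H"
    using assms(1) uv by (auto simp: inj_on_def doubleton_eq_iff)
  then show "card ((\<lambda>c. {u c, v c}) ` H) = card H"
    by (rule card_image)
  show "card {u c, v c} = 2" if "c \<in> H"
    using uv that by simp
qed

theorem theorem4p3:
  fixes K :: "'a two_ops set" and R :: "'a two_ops rel"
  assumes "\<exists>A :: 'a set. card A = 3"
  defines "K \<equiv> nonab_noncomm_nontriv_3"
  defines "R \<equiv> iso_rel_on K"
  shows "equiv K R \<and> card (K // R) = 21 \<and>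
    (\<exists>S P. S \<in> K // R \<and> (\<forall>D\<in>K. iso_dual_dimonoid D \<longleftrightarrow> D \<in> S) \<and>
      partition_on (K // R - {S}) P \<and> card P = 10 \<and>
      (\<forall>p\<in>P. card p = 2 \<and>
        (\<exists>D\<in>K. dual_dimonoid D \<in> K \<and> \<not> isomorphic_dimonoids D (dual_dimonoid D) \<and>
          p = {R `` {D}, R `` {dual_dimonoid D}})))"
proof -
  \<comment> \<open>Three elements of \<open>'a\<close> give an injection \<open>g\<close> of
    \<open>pt\<close>, fixed from here on, along which all codes are realized.\<close>
  obtain A :: "'a set" where A: "card A = 3"
    using assms(1) by blast
  then have "finite (UNIV :: pt set)" "finite A" "card (UNIV :: pt set) = card A"
    by (auto simp: UNIV_pt intro: card_ge_0_finite)
  then obtain g where "bij_betw g (UNIV :: pt set) A"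
    using finite_same_card_bij by blast
  then have g: "inj g"
    by (simp add: bij_betw_def)
  have eq: "equiv K R"
    unfolding K_def R_def by (rule equiv_iso_rel_on)
  have R_iff: "(D, E) \<in> R \<longleftrightarrow> isomorphic_dimonoids D E" if "D \<in> K" "E \<in> K" for D E
    using that by (simp add: R_def iso_rel_on_def)
  define cl where "cl c = R `` {realize g c}" for c
  have reps_K: "realize g c \<in> K" if "c \<in> set reps" for c
    using nonab_noncomm_nontriv_code_reps that
    by (simp add: K_def realize_in_nonab_noncomm_nontriv_3_iff [OF g] list_all_iff)
  have cl_eq_iff: "cl c = cl d \<longleftrightarrow> similar c d" if "c \<in> set reps" "d \<in> set reps" for c d
    unfolding cl_def using that
    by (simp add: eq_equiv_class_iff [OF eq] reps_K R_iff isomorphic_realize_iff [OF g])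
  have rep: "\<exists>c\<in>set reps. isomorphic_dimonoids D (realize g c) \<and> R `` {D} = cl c" if D: "D \<in> K" for D
  proof -
    obtain c where c: "isomorphic_dimonoids D (realize g c)"
      using D g by (auto simp: K_def nonab_noncomm_nontriv_3_def elim: isomorphic_realize)
    then have "nonab_noncomm_nontriv_code c"
      using D nonab_noncomm_nontriv_3_isomorphic
      unfolding K_def realize_in_nonab_noncomm_nontriv_3_iff [OF g, symmetric] by blast
    then obtain d where d: "d \<in> set reps" "similar c d"
      by (rule nonab_noncomm_nontriv_code_similar_rep)
    then have "isomorphic_dimonoids D (realize g d)"
      using c isomorphic_dimonoids_trans isomorphic_realize_iff [OF g] by blast
    then show ?thesis
      using d(1) D reps_K by (intro bexI [of _ d]) (simp_all add: cl_def eq_equiv_class_iff [OF eq] R_iff)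
  qed
  have quotient: "K // R = cl ` set reps"
  proof
    show "K // R \<subseteq> cl ` set reps"
      using rep by (auto elim!: quotientE)
    show "cl ` set reps \<subseteq> K // R"
      using reps_K by (auto simp: cl_def intro: quotientI)
  qed
  have "sorted_wrt (\<lambda>c d. cl c \<noteq> cl d) reps"
    using reps_dissimilar by (rule sorted_wrt_mono_rel [rotated]) (simp add: cl_eq_iff dissimilar_def)
  then have "distinct (map cl reps)"
    by (simp add: sorted_wrt_map flip: sorted_wrt_neq_iff_distinct)
  then have "distinct reps" and inj: "inj_on cl (set reps)"
    by (simp_all add: distinct_map)
  define H where "H = set half_reps"
  \<comment> \<open>Distinctness of the concatenated list says at once that no code in
    \<open>H\<close> is the dual of a code in \<open>H\<close> and that \<open>self_dual_rep\<close>
    lies on neither side.\<close>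
  have "distinct half_reps" and disjoint: "H \<inter> dual_code ` H = {}"
    and self: "self_dual_rep \<notin> H \<union> dual_code ` H"
    using \<open>distinct reps\<close> by (auto simp: reps_def H_def)
  have card_H: "card H = 10"
    using \<open>distinct half_reps\<close> by (simp add: H_def distinct_card length_half_reps)
  have reps: "set reps = insert self_dual_rep (H \<union> dual_code ` H)"
    by (simp add: reps_def H_def)
  have "length reps = 21"
    by (simp add: reps_def length_half_reps)
  then have "card (K // R) = 21"
    using distinct_card [OF \<open>distinct (map cl reps)\<close>] by (simp add: quotient)
  define S where "S = cl self_dual_rep"
  define P where "P = (\<lambda>c. {cl c, cl (dual_code c)}) ` H"
  have sub: "H \<subseteq> set reps" "dual_code ` H \<subseteq> set reps"
    unfolding reps by blast+
  have "inj_on cl H"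
    using inj sub(1) by (rule inj_on_subset)
  moreover have "inj_on dual_code H"
    by (rule inj_on_inverseI) (rule dual_code_dual_code)
  then have "inj_on (cl \<circ> dual_code) H"
    using inj_on_subset [OF inj sub(2)] by (rule comp_inj_on)
  \<comment> \<open>Since \<open>cl\<close> is injective on all of \<open>set reps\<close>, disjoint
    sets of representatives have disjoint images.\<close>
  moreover have "cl ` H \<inter> (cl \<circ> dual_code) ` H = {}"
    using inj_on_image_Int [OF inj sub] unfolding disjoint image_comp image_empty by (rule sym)
  ultimately have pairs: "partition_on (cl ` H \<union> (cl \<circ> dual_code) ` H) P" "card P = 10"
    "\<And>c. c \<in> H \<Longrightarrow> card {cl c, cl (dual_code c)} = 2"
    using partition_on_pairs [of cl H "cl \<circ> dual_code"] card_H
    unfolding P_def comp_def by simp_all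
  have "S \<notin> cl ` (H \<union> dual_code ` H)"
  proof -
    have "self_dual_rep \<in> set reps" "H \<union> dual_code ` H \<subseteq> set reps"
      unfolding reps by blast+
    then show ?thesis
      unfolding S_def using self by (simp only: inj_on_image_mem_iff [OF inj] not_False_eq_True)
  qed
  then have rest: "K // R - {S} = cl ` H \<union> (cl \<circ> dual_code) ` H"
    unfolding quotient reps image_insert image_Un image_comp S_def by (rule Diff_insert_absorb)
  \<comment> \<open>For any other representative the dual code is a representative as well.
    Similarity would make the two equal, against the disjointness of \<open>H\<close> and its
    dual.\<close>
  have similar_dual_iff: "similar c (dual_code c) \<longleftrightarrow> c = self_dual_rep" if "c \<in> set reps" for c
  proof
    assume "similar c (dual_code c)"
    show "c = self_dual_rep"
    proof (rule ccontr)
      assume "c \<noteq> self_dual_rep"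
      then have "c \<in> H \<or> dual_code c \<in> H"
        using that unfolding reps by (metis UnE dual_code_dual_code imageE insertE)
      then have "dual_code c \<in> set reps"
        using sub by blast
      then have "c = dual_code c"
        using \<open>similar c (dual_code c)\<close> cl_eq_iff [OF that] inj_onD [OF inj _ that] by blast
      then have "c \<in> H \<inter> dual_code ` H"
        using \<open>c \<in> H \<or> dual_code c \<in> H\<close> by (metis IntI image_eqI)
      then show False
        unfolding disjoint by (rule emptyE)
    qed
  qed (use similar_dual_self_dual_rep in simp)
  have "iso_dual_dimonoid D \<longleftrightarrow> D \<in> S" if D: "D \<in> K" for D
  proof -
    obtain c where c: "c \<in> set reps" "isomorphic_dimonoids D (realize g c)" "R `` {D} = cl c"
      using rep D by blast
    have dim: "dimonoid D" "dimonoid (realize g c)"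
      using D reps_K [OF c(1)] by (simp_all add: K_def nonab_noncomm_nontriv_3_def)
    \<comment> \<open>Being iso-dual is invariant under isomorphism, so it can be tested on the
      representative of \<open>D\<close>.\<close>
    have "iso_dual_dimonoid D \<longleftrightarrow> iso_dual_dimonoid (realize g c)"
      using dim c(2) iso_dual_dimonoid_isomorphic isomorphic_dimonoids_sym by blast
    also have "\<dots> \<longleftrightarrow> c = self_dual_rep"
      by (simp add: iso_dual_dimonoid_def dual_dimonoid_realize isomorphic_realize_iff [OF g]
        similar_dual_iff [OF c(1)])
    also have "\<dots> \<longleftrightarrow> cl self_dual_rep = R `` {D}"
      using inj c(1,3) reps by (metis inj_onD insertI1)
    also have "\<dots> \<longleftrightarrow> (realize g self_dual_rep, D) \<in> R"
      unfolding cl_def using D reps_K reps by (intro eq_equiv_class_iff [OF eq]) auto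
    finally show ?thesis
      by (simp add: S_def cl_def)
  qed
  moreover have "\<exists>D\<in>K. dual_dimonoid D \<in> K \<and> \<not> isomorphic_dimonoids D (dual_dimonoid D) \<and>
      p = {R `` {D}, R `` {dual_dimonoid D}}" if "p \<in> P" for p
  proof -
    obtain c where c: "c \<in> H" "p = {cl c, cl (dual_code c)}"
      using \<open>p \<in> P\<close> unfolding P_def by blast
    then have "c \<in> set reps" "dual_code c \<in> set reps" "c \<noteq> self_dual_rep"
      using sub self by blast+
    then show ?thesis
      using c(2) reps_K by (intro bexI [of _ "realize g c"])
        (simp_all add: dual_dimonoid_realize isomorphic_realize_iff [OF g] similar_dual_iff cl_def)
  qed
  moreover have "card p = 2" if "p \<in> P" for p
    using that pairs(3) unfolding P_def by blast
  moreover have "S \<in> K // R"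
    unfolding quotient reps S_def by blast
  ultimately show ?thesis
    using eq \<open>card (K // R) = 21\<close> pairs(1,2) unfolding rest [symmetric] by blast
qed

end
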